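(* Let $1\le p<\infty$ and $\lambda\in(0,n)$. Let $L$ be an operator which generates a semigroup $e^{-tL}$ whose kernels $p_t(x,y)$ satisfy the heat kernel bounds stated in the context. Then the following are equivalent: (1) $\mathrm{L}^{p,\lambda}(\mathbb R^n)\subseteq \mathrm{L}^{p,\lambda}_L(\mathbb R^n)$, and there is a constant $c>0$ such that $\|f\|_{\mathrm{L}^{p,\lambda}_L}\le c\,\|f\|_{\mathrm{L}^{p,\lambda}}$ for all $f\in \mathrm{L}^{p,\lambda}(\mathbb R^n)$; (2) for every $t>0$, $e^{-tL}(1)=1$ almost everywhere, that is, $\int_{\mathbb R^n}p_t(x,y)\,dy=1$ for almost all $x\in\mathbb R^n$.
   Context: Operator: $L$ is a linear operator of type $\omega$ on $\mathrm{L}^2(\mathbb R^n)$ for some $0\le\omega<\pi/2$, i.e. $L$ is closed, its spectrum is contained in $S_\omega=\{z\in\mathbb C:|\arg z|\le\omega\}\cup\{0\}$, and for each $\nu>\omega$ there is $c_\nu$ with $\|(L-\zeta \mathcal I)^{-1}\|_{\mathrm{L}^2\to \mathrm{L}^2}\le c_\nu|\zeta|^{-1}$ for all $\zeta\notin S_\nu$; hence $L$ generates an analytic semigroup $\{e^{-tL}\}$ on $\mathrm{L}^2(\mathbb R^n)$. Heat kernel bounds: for $t>0$, $e^{-tL}$ is represented by a kernel $p_t(x,y)$ with $|p_t(x,y)|\le c\,t^{-n/m}g\big(|x-y|/t^{1/m}\big)$ for all $x,y\in\mathbb R^n$, where $m>0$ is a constant and $g$ is a positive, bounded, decreasing function with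 $\lim_{r\to\infty}r^{n+\epsilon}g(r)=0$ for some $\epsilon>0$. Function class $\mathcal M_p$: for $\beta>0$, $\mathcal M_{(p;\beta)}$ is the set of complex-valued $f\in \mathrm{L}^p_{\rm loc}(\mathbb R^n)$ with $\int_{\mathbb R^n}|f(x)|^p(1+|x|)^{-(n+\beta)}dx<\infty$. Put $\Theta(L)=\sup\{\epsilon>0:\lim_{r\to\infty}r^{n+\epsilon}g(r)=0\}$, where $g$ is the function in the heat kernel bound. Then $\mathcal M_p=\mathcal M_{(p;\Theta(L))}$ if $\Theta(L)<\infty$ and $\mathcal M_p=\bigcup_{0<\beta<\infty}\mathcal M_{(p;\beta)}$ if $\Theta(L)=\infty$. For $f\in\mathcal M_p$ and $t>0$, $P_tf(x)=e^{-tL}f(x)=\int_{\mathbb R^n}p_t(x,y)f(y)\,dy$. Morrey spaces: balls $B$ are Euclidean open balls with radius $r_B$; $f_B=|B|^{-1}\int_Bf(x)\,dx$; $t_B=r_B^m$. The space $\mathrm{L}^{p,\lambda}(\mathbb R^n)$ consists of all $f\in \mathrm{L}^p_{\rm loc}(\mathbb R^n)$ with $$\|f\|_{\mathrm{L}^{p,\lambda}}=\sup_{B\subset\mathbb R^n}\Big[r_B^{-\lambda}\int_B|f(x)-f_B|^pdx\Big]^{1/p}<\infty .$$ The space $\mathrm{L}^{p,\lambda}_L(\mathbb R^n)$ consists of all $f\in\mathcal M_p$ with $$\|f\|_{\mathrm{L}^{p,\lambda}_L}=\sup_{B\subset\mathbb R^n}\Big[r_B^{-\lambda}\int_B|f(x)-P_{t_B}f(x)|^pdx\Big]^{1/p}<\infty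 .$$ *)

theory Defs
  imports "HOL-Analysis.Analysis"
begin

section \<open>Operators on the space of square integrable functions\<close>

text \<open>
  Elements of \<open>L\<^sup>2\<close> are represented by Lebesgue measurable functions, so every notion below is
  understood modulo equality almost everywhere; \<open>L2_norm\<close> is a seminorm on functions.
\<close>

definition L2 :: "('a::euclidean_space \<Rightarrow> complex) set" where
  "L2 = {f \<in> borel_measurable lebesgue. integrable lebesgue (\<lambda>x. (norm (f x))\<^sup>2)}"

definition L2_norm :: "('a::euclidean_space \<Rightarrow> complex) \<Rightarrow> real" where
  "L2_norm f = sqrt (LINT x|lebesgue. (norm (f x))\<^sup>2)"

text \<open>
  A possibly unbounded, partially defined operator is given by its graph. The clauses of
  \<open>L2_operator\<close> say that the graph is a linear subspace, that it is saturated for equality almost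
  everywhere (so it comes from a set of pairs of classes), and that it is single-valued on classes.
\<close>

type_synonym 'a operator = "(('a \<Rightarrow> complex) \<times> ('a \<Rightarrow> complex)) set"

definition L2_operator :: "'a::euclidean_space operator \<Rightarrow> bool" where
  "L2_operator A \<longleftrightarrow>
     A \<subseteq> L2 \<times> L2 \<and>
     ((\<lambda>_. 0), (\<lambda>_. 0)) \<in> A \<and>
     (\<forall>(f, g) \<in> A. \<forall>(f', g') \<in> A. ((\<lambda>x. f x + f' x), (\<lambda>x. g x + g' x)) \<in> A) \<and>
     (\<forall>(f, g) \<in> A. \<forall>z. ((\<lambda>x. z * f x), (\<lambda>x. z * g x)) \<in> A) \<and>
     (\<forall>(f, g) \<in> A. \<forall>f' \<in> L2. \<forall>g' \<in> L2.
        (AE x in lebesgue. f' x = f x) \<longrightarrow> (AE x in lebesgue. g' x = g x) \<longrightarrow> (f', g') \<in> A) \<and>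
     (\<forall>f g g'. (f, g) \<in> A \<longrightarrow> (f, g') \<in> A \<longrightarrow> (AE x in lebesgue. g x = g' x))"

definition L2_closed :: "'a::euclidean_space operator \<Rightarrow> bool" where
  "L2_closed A \<longleftrightarrow>
     (\<forall>u v f g. (\<forall>k::nat. (u k, v k) \<in> A) \<longrightarrow> f \<in> L2 \<longrightarrow> g \<in> L2 \<longrightarrow>
        (\<lambda>k. L2_norm (\<lambda>x. u k x - f x)) \<longlonglongrightarrow> 0 \<longrightarrow>
        (\<lambda>k. L2_norm (\<lambda>x. v k x - g x)) \<longlonglongrightarrow> 0 \<longrightarrow> (f, g) \<in> A)"

definition op_norm_le :: "'a::euclidean_space operator \<Rightarrow> real \<Rightarrow> bool" where
  "op_norm_le A C \<longleftrightarrow> (\<forall>(f, g) \<in> A. L2_norm g \<le> C * L2_norm f)"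

definition L2_bounded_operator :: "'a::euclidean_space operator \<Rightarrow> bool" where
  "L2_bounded_operator A \<longleftrightarrow> L2_operator A \<and> Domain A = L2 \<and> (\<exists>C. op_norm_le A C)"

text \<open>
  The relation \<open>(A - \<zeta> I)\<^sup>-\<^sup>1\<close>. It is an operator iff \<open>A - \<zeta> I\<close> is injective, and its domain is
  the range of \<open>A - \<zeta> I\<close>.
\<close>

definition resolvent :: "'a::euclidean_space operator \<Rightarrow> complex \<Rightarrow> 'a operator" where
  "resolvent A \<zeta> = {((\<lambda>x. g x - \<zeta> * f x), f) | f g. (f, g) \<in> A}"

definition spectrum :: "'a::euclidean_space operator \<Rightarrow> complex set" where
  "spectrum A = {\<zeta>. \<not> L2_bounded_operator (resolvent A \<zeta>)}"

definition sector :: "real \<Rightarrow> complex set" where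
  "sector \<nu> = {z. \<bar>Arg z\<bar> \<le> \<nu>} \<union> {0}"

definition operator_of_type :: "real \<Rightarrow> 'a::euclidean_space operator \<Rightarrow> bool" where
  "operator_of_type \<omega> A \<longleftrightarrow>
     L2_operator A \<and> L2_closed A \<and> spectrum A \<subseteq> sector \<omega> \<and>
     (\<forall>\<nu>>\<omega>. \<exists>c. \<forall>\<zeta>. \<zeta> \<notin> sector \<nu> \<longrightarrow> op_norm_le (resolvent A \<zeta>) (c / norm \<zeta>))"

text \<open>
  \<open>T t\<close> maps representatives to representatives; \<open>L2_graph (T t)\<close> is the operator it induces on
  classes. \<open>generates_semigroup A T\<close> says that \<open>T t = e\<^sup>-\<^sup>t\<^sup>A\<close>, i.e. that \<open>T\<close> is the strongly
  continuous semigroup with infinitesimal generator \<open>-A\<close>. This determines \<open>T t\<close> on classes; for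
  \<open>A\<close> of type \<open>\<omega> < \<pi>/2\<close> such a \<open>T\<close> exists and is analytic.
\<close>

definition L2_graph :: "(('a::euclidean_space \<Rightarrow> complex) \<Rightarrow> ('a \<Rightarrow> complex)) \<Rightarrow> 'a operator" where
  "L2_graph S = {(f, g). f \<in> L2 \<and> g \<in> L2 \<and> (AE x in lebesgue. g x = S f x)}"

definition C0_semigroup ::
    "(real \<Rightarrow> ('a::euclidean_space \<Rightarrow> complex) \<Rightarrow> ('a \<Rightarrow> complex)) \<Rightarrow> bool" where
  "C0_semigroup T \<longleftrightarrow>
     (\<forall>t\<ge>0. L2_bounded_operator (L2_graph (T t))) \<and>
     (\<forall>f\<in>L2. AE x in lebesgue. T 0 f x = f x) \<and>
     (\<forall>s\<ge>0. \<forall>t\<ge>0. \<forall>f\<in>L2. AE x in lebesgue. T (s + t) f x = T s (T t f) x) \<and>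
     (\<forall>f\<in>L2. ((\<lambda>t. L2_norm (\<lambda>x. T t f x - f x)) \<longlongrightarrow> 0) (at_right 0))"

definition generates_semigroup ::
    "'a::euclidean_space operator \<Rightarrow>
     (real \<Rightarrow> ('a \<Rightarrow> complex) \<Rightarrow> ('a \<Rightarrow> complex)) \<Rightarrow> bool" where
  "generates_semigroup A T \<longleftrightarrow>
     C0_semigroup T \<and>
     A = {(f, g). f \<in> L2 \<and> g \<in> L2 \<and>
            ((\<lambda>t. L2_norm (\<lambda>x. (f x - T t f x) / of_real t - g x)) \<longlongrightarrow> 0) (at_right 0)}"

section \<open>Heat kernel bounds\<close>

definition represented_by_kernel ::
    "(real \<Rightarrow> ('a::euclidean_space \<Rightarrow> complex) \<Rightarrow> ('a \<Rightarrow> complex)) \<Rightarrow>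
     (real \<Rightarrow> 'a \<Rightarrow> 'a \<Rightarrow> complex) \<Rightarrow> bool" where
  "represented_by_kernel T k \<longleftrightarrow>
     (\<forall>t>0. (\<lambda>(x, y). k t x y) \<in> borel_measurable lebesgue \<and>
        (\<forall>f\<in>L2. AE x in lebesgue.
           has_bochner_integral lebesgue (\<lambda>y. k t x y * f y) (T t f x)))"

definition admissible_profile :: "nat \<Rightarrow> (real \<Rightarrow> real) \<Rightarrow> bool" where
  "admissible_profile n g \<longleftrightarrow>
     (\<forall>r\<ge>0. g r > 0) \<and> bounded (g ` {0..}) \<and> antimono_on {0..} g \<and>
     (\<exists>\<epsilon>>0. ((\<lambda>r. r powr (real n + \<epsilon>) * g r) \<longlongrightarrow> 0) at_top)"

definition heat_kernel_bound ::
    "real \<Rightarrow> (real \<Rightarrow> real) \<Rightarrow> (real \<Rightarrow> 'a::euclidean_space \<Rightarrow> 'a \<Rightarrow> complex) \<Rightarrow> bool" where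
  "heat_kernel_bound m g k \<longleftrightarrow>
     admissible_profile DIM('a) g \<and>
     (\<exists>c. \<forall>t>0. \<forall>x y.
        norm (k t x y) \<le> c * t powr (- (real DIM('a) / m)) * g (norm (x - y) / t powr (1 / m)))"

section \<open>The function class of admissible growth and the extended semigroup\<close>

definition Lp_loc :: "real \<Rightarrow> ('a::euclidean_space \<Rightarrow> complex) set" where
  "Lp_loc p = {f \<in> borel_measurable lebesgue.
     \<forall>K. compact K \<longrightarrow> set_integrable lebesgue K (\<lambda>x. norm (f x) powr p)}"

definition M_class :: "real \<Rightarrow> real \<Rightarrow> ('a::euclidean_space \<Rightarrow> complex) set" where
  "M_class p \<beta> = {f \<in> Lp_loc p.
     integrable lebesgue
       (\<lambda>x. norm (f x) powr p * (1 + norm x) powr (- (real DIM('a) + \<beta>)))}"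

definition Theta :: "nat \<Rightarrow> (real \<Rightarrow> real) \<Rightarrow> ereal" where
  "Theta n g =
     Sup (ereal ` {\<epsilon>. \<epsilon> > 0 \<and> ((\<lambda>r. r powr (real n + \<epsilon>) * g r) \<longlongrightarrow> 0) at_top})"

definition M_space :: "real \<Rightarrow> (real \<Rightarrow> real) \<Rightarrow> ('a::euclidean_space \<Rightarrow> complex) set" where
  "M_space p g =
     (if Theta DIM('a) g = \<infinity> then (\<Union>\<beta>\<in>{0<..}. M_class p \<beta>)
      else M_class p (real_of_ereal (Theta DIM('a) g)))"

definition kernel_op ::
    "(real \<Rightarrow> 'a::euclidean_space \<Rightarrow> 'a \<Rightarrow> complex) \<Rightarrow>
     real \<Rightarrow> ('a \<Rightarrow> complex) \<Rightarrow> 'a \<Rightarrow> complex" where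
  "kernel_op k t f x = (LINT y|lebesgue. k t x y * f y)"

section \<open>Morrey spaces\<close>

text \<open>
  The suprema defining the norms are real-valued, so they are meaningful only on the corresponding
  spaces, where boundedness of the set of values is required.
\<close>

definition ball_mean :: "('a::euclidean_space \<Rightarrow> complex) \<Rightarrow> 'a \<Rightarrow> real \<Rightarrow> complex" where
  "ball_mean f z r =
     (LINT x:ball z r|lebesgue. f x) /\<^sub>R measure lebesgue (ball z r)"

definition morrey_osc ::
    "real \<Rightarrow> real \<Rightarrow> ('a::euclidean_space \<Rightarrow> complex) \<Rightarrow> 'a \<times> real \<Rightarrow> real" where
  "morrey_osc p lam f = (\<lambda>(z, r).
     (r powr (- lam) *
        (LINT x:ball z r|lebesgue. norm (f x - ball_mean f z r) powr p)) powr (1 / p))"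

definition morrey_space :: "real \<Rightarrow> real \<Rightarrow> ('a::euclidean_space \<Rightarrow> complex) set" where
  "morrey_space p lam = {f \<in> Lp_loc p. bdd_above (morrey_osc p lam f ` (UNIV \<times> {0<..}))}"

definition morrey_norm :: "real \<Rightarrow> real \<Rightarrow> ('a::euclidean_space \<Rightarrow> complex) \<Rightarrow> real" where
  "morrey_norm p lam f = (SUP B\<in>UNIV \<times> {0<..}. morrey_osc p lam f B)"

definition morrey_osc_L ::
    "(real \<Rightarrow> 'a::euclidean_space \<Rightarrow> 'a \<Rightarrow> complex) \<Rightarrow> real \<Rightarrow>
     real \<Rightarrow> real \<Rightarrow> ('a \<Rightarrow> complex) \<Rightarrow> 'a \<times> real \<Rightarrow> real" where
  "morrey_osc_L k m p lam f = (\<lambda>(z, r).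
     (r powr (- lam) *
        (LINT x:ball z r|lebesgue. norm (f x - kernel_op k (r powr m) f x) powr p)) powr (1 / p))"

text \<open>
  Bochner integrals of non-integrable functions are \<open>0\<close> in the library. The two integrability
  clauses exclude this artefact: the integral defining \<open>P\<^sub>t f\<close> converges almost everywhere, and
  the integrals of \<open>|f - P\<^sub>t f|\<^sup>p\<close> over balls are finite.
\<close>

definition morrey_space_L ::
    "(real \<Rightarrow> 'a::euclidean_space \<Rightarrow> 'a \<Rightarrow> complex) \<Rightarrow> real \<Rightarrow> (real \<Rightarrow> real) \<Rightarrow>
     real \<Rightarrow> real \<Rightarrow> ('a \<Rightarrow> complex) set" where
  "morrey_space_L k m g p lam = {f \<in> M_space p g.
     (\<forall>t>0. AE x in lebesgue. integrable lebesgue (\<lambda>y. k t x y * f y)) \<and>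
     (\<forall>z. \<forall>r>0. set_integrable lebesgue (ball z r)
        (\<lambda>x. norm (f x - kernel_op k (r powr m) f x) powr p)) \<and>
     bdd_above (morrey_osc_L k m p lam f ` (UNIV \<times> {0<..}))}"

definition morrey_norm_L ::
    "(real \<Rightarrow> 'a::euclidean_space \<Rightarrow> 'a \<Rightarrow> complex) \<Rightarrow> real \<Rightarrow>
     real \<Rightarrow> real \<Rightarrow> ('a \<Rightarrow> complex) \<Rightarrow> real" where
  "morrey_norm_L k m p lam f = (SUP B\<in>UNIV \<times> {0<..}. morrey_osc_L k m p lam f B)"

end

theory Submission
  imports Defs
begin

text \<open>
  Testing the inclusion on the constant function \<open>1\<close>, whose Morrey norm vanishes, forces
  \<open>P\<^sub>t 1 = 1\<close>. Conversely, if \<open>P\<^sub>t 1 = 1\<close>, then on a ball \<open>B\<close> of radius \<open>r = t\<^bsup>1/m\<^esup>\<close> we have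
  \<open>f - P\<^sub>t f = (f - f\<^sub>B) - P\<^sub>t (f - f\<^sub>B)\<close> almost everywhere. Since \<open>\<lambda> < n\<close>, the means of \<open>f\<close> over the
  balls \<open>2\<^sup>k B\<close> telescope to within a constant times \<open>\<parallel>f\<parallel> r\<^bsup>(\<lambda> - n)/p\<^esup>\<close> of \<open>f\<^sub>B\<close>, so
  \<open>\<integral>|f - f\<^sub>B|\<^sup>p\<close> over \<open>2\<^sup>k B\<close> is at most a constant times \<open>\<parallel>f\<parallel>\<^sup>p r\<^sup>\<lambda> 2\<^bsup>kn\<^esup>\<close>. Summing over dyadic
  annuli against the kernel decay \<open>(1 + |y - z|/r)\<^bsup>-(n + \<beta>)\<^esup>\<close> bounds \<open>P\<^sub>t (f - f\<^sub>B)\<close> pointwise on \<open>B\<close>; the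
  same summation shows that \<open>f\<close> has admissible growth.
\<close>

section \<open>Dyadic summation\<close>

text \<open>
  Young's inequality in this form replaces Hoelder's: at the scale \<open>d = N r\<^bsup>(\<lambda> - n)/p\<^esup>\<close> both terms have
  the same size.
\<close>
lemma le_add_powr:
  fixes a d p :: real
  assumes "1 \<le> p" "0 \<le> a" "0 < d"
  shows "a \<le> d + d powr (1 - p) * a powr p"
proof (cases "a \<le> d")
  case True
  then show ?thesis using assms by (simp add: add_increasing2)
next
  case False
  then have "a = a powr (1 - p) * a powr p"
    using assms by (simp add: powr_add[symmetric])
  also have "\<dots> \<le> d powr (1 - p) * a powr p"
    using False assms by (intro mult_right_mono powr_mono2') auto
  finally show ?thesis using assms by simp
qed

text \<open>Bounding the sum by twice the maximum avoids convexity; the sharp constant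
  \<open>2 powr (p - 1)\<close> is of no interest here.\<close>

lemma powr_add_le:
  fixes a b p :: real
  assumes "0 \<le> p" "0 \<le> a" "0 \<le> b"
  shows "(a + b) powr p \<le> 2 powr p * (a powr p + b powr p)"
proof -
  have "(a + b) powr p \<le> (2 * max a b) powr p"
    using assms by (intro powr_mono2) auto
  also have "\<dots> = 2 powr p * max a b powr p"
    using assms by (simp add: powr_mult)
  also have "max a b powr p \<le> a powr p + b powr p"
    by (simp add: max_def)
  finally show ?thesis by simp
qed

text \<open>Where \<open>2 ^ k * r\<close> is the first dyadic radius exceeding the distance to
  \<open>z\<close>, the weight is at most a constant times
  \<open>2 powr (- k (n + \<beta>))\<close>, with \<open>n\<close> the dimension. Against growth
  \<open>2 powr (k n)\<close> of the integrals this leaves a geometric series of ratio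
  \<open>2 powr (- \<beta>)\<close>, whose sum is the denominator of \<open>C\<close>.\<close>

lemma dyadic_weight:
  fixes F :: "'a::euclidean_space \<Rightarrow> real"
  assumes F: "F \<in> borel_measurable lebesgue" "\<And>y. 0 \<le> F y"
    and int: "\<And>k::nat. set_integrable lebesgue (ball z (2 ^ k * r)) F"
    and le: "\<And>k::nat. (LINT y:ball z (2 ^ k * r)|lebesgue. F y) \<le> M * 2 powr (real k * real DIM('a))"
    and r: "0 < r" and \<beta>: "0 < \<beta>"
  defines "w \<equiv> \<lambda>y. (1 + norm (y - z) / r) powr (- (real DIM('a) + \<beta>))"
  defines "C \<equiv> 2 powr (real DIM('a) + \<beta>) / (1 - 2 powr (- \<beta>))"
  shows "integrable lebesgue (\<lambda>y. F y * w y)"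
    and "(LINT y|lebesgue. F y * w y) \<le> C * M"
proof -
  define s where "s = real DIM('a) + \<beta>"
  have s: "s > 0" using \<beta> by (simp add: s_def)
  \<comment> \<open>The majorants live on full balls instead of annuli: as \<open>F\<close> is
    nonnegative, it suffices that for each \<open>y\<close> a single term dominates.\<close>
  define G where "G k y = F y * indicator (ball z (2 ^ k * r)) y * (2 powr s * 2 powr (- (real k * s)))"
    for k :: nat and y
  have w: "\<exists>k. y \<in> ball z (2 ^ k * r) \<and> w y \<le> 2 powr s * 2 powr (- (real k * s))" for y
  proof -
    define k where "k = (LEAST k. norm (y - z) < 2 ^ k * r)"
    have "\<exists>k. norm (y - z) / r < 2 ^ k"
      by (rule real_arch_pow) simp
    then have ex: "\<exists>k. norm (y - z) < 2 ^ k * r" using r by (simp add: field_simps)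
    have 1: "norm (y - z) < 2 ^ k * r" unfolding k_def using ex by (rule LeastI_ex)
    \<comment> \<open>By minimality of \<open>k\<close> the point lies outside the previous ball;
      for \<open>k = 0\<close> there is no previous ball and the summand 1 suffices.\<close>
    have "2 powr (real k - 1) \<le> 1 + norm (y - z) / r"
    proof (cases k)
      case 0
      have "2 powr (-1 :: real) \<le> 1" by (simp add: powr_minus)
      then show ?thesis using r 0 by (simp add: add_increasing2)
    next
      case (Suc j)
      then have "\<not> norm (y - z) < 2 ^ j * r"
        using not_less_Least[of j "\<lambda>k. norm (y - z) < 2 ^ k * r"] by (simp add: k_def)
      then show ?thesis using Suc r by (simp add: powr_realpow field_simps)
    qed
    then have "w y \<le> (2 powr (real k - 1)) powr (- s)"
      unfolding w_def s_def[symmetric] using s by (intro powr_mono2') auto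
    also have "\<dots> = 2 powr s * 2 powr (- (real k * s))"
      by (simp add: powr_powr powr_add[symmetric] algebra_simps)
    finally show ?thesis using 1 by (auto simp: dist_norm norm_minus_commute)
  qed
  have G0: "0 \<le> G k y" for k y using F(2) by (simp add: G_def)
  have Gm: "(\<lambda>y. ennreal (G k y)) \<in> borel_measurable lebesgue" for k
    unfolding G_def using F(1)
    by (intro measurable_compose[OF _ measurable_ennreal] borel_measurable_times
        borel_measurable_indicator borel_measurable_const) auto
  have GI: "(\<integral>\<^sup>+y. ennreal (G k y) \<partial>lebesgue) \<le> ennreal (2 powr s * M * (2 powr (- \<beta>)) ^ k)" for k
  proof -
    have i: "integrable lebesgue (\<lambda>y. F y * indicator (ball z (2 ^ k * r)) y)"
      using int[of k] by (simp add: set_integrable_def mult.commute)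
    have iG: "integrable lebesgue (G k)"
      unfolding G_def by (rule integrable_mult_left[OF i])
    have "(LINT y|lebesgue. G k y) =
        (LINT y:ball z (2 ^ k * r)|lebesgue. F y) * (2 powr s * 2 powr (- (real k * s)))"
      unfolding G_def by (simp add: set_lebesgue_integral_def mult.commute)
    also have "\<dots> \<le> (M * 2 powr (real k * real DIM('a))) * (2 powr s * 2 powr (- (real k * s)))"
      by (rule mult_right_mono[OF le]) simp
    also have "\<dots> = 2 powr s * M * (2 powr (- \<beta>)) ^ k"
      by (simp add: s_def powr_realpow[symmetric] powr_powr powr_add[symmetric] powr_minus_divide
          field_simps)
    finally show ?thesis
      using iG G0 by (subst nn_integral_eq_integral) (auto intro: ennreal_leI)
  qed
  have M: "0 \<le> M"
  proof -
    have "0 \<le> (LINT y:ball z (2 ^ 0 * r)|lebesgue. F y)"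
      unfolding set_lebesgue_integral_def using F(2) by (intro integral_nonneg_AE) auto
    then show ?thesis using le[of 0] by simp
  qed
  have q: "2 powr (- \<beta>) < 1" using \<beta> by (simp add: powr_less_one)
  have sums: "(\<lambda>k. 2 powr s * M * (2 powr (- \<beta>)) ^ k) sums (C * M)"
    using sums_mult[OF geometric_sums[of "2 powr (- \<beta>)"], of "2 powr s * M"] q
    by (simp add: C_def s_def field_simps)
  \<comment> \<open>Working with nonnegative integrals allows the exchange of sum and integral
    before integrability is known; finiteness of the result then yields integrability.\<close>
  have "(\<integral>\<^sup>+y. ennreal (F y * w y) \<partial>lebesgue) \<le> (\<integral>\<^sup>+y. (\<Sum>k. ennreal (G k y)) \<partial>lebesgue)"
  proof (rule nn_integral_mono)
    fix y
    obtain k where k: "y \<in> ball z (2 ^ k * r)" "w y \<le> 2 powr s * 2 powr (- (real k * s))"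
      using w by blast
    have "ennreal (F y * w y) \<le> ennreal (G k y)"
      unfolding G_def using k F(2) by (intro ennreal_leI) (simp add: mult_left_mono)
    also have "\<dots> \<le> (\<Sum>k. ennreal (G k y))"
      using sum_le_suminf[of "\<lambda>k. ennreal (G k y)" "{k}"] by simp
    finally show "ennreal (F y * w y) \<le> (\<Sum>k. ennreal (G k y))" .
  qed
  also have "\<dots> = (\<Sum>k. \<integral>\<^sup>+y. ennreal (G k y) \<partial>lebesgue)"
    by (rule nn_integral_suminf) (rule Gm)
  also have "\<dots> \<le> (\<Sum>k. ennreal (2 powr s * M * (2 powr (- \<beta>)) ^ k))"
    by (intro suminf_le GI) auto
  also have "\<dots> = ennreal (C * M)"
    using sums M by (subst suminf_ennreal2) (auto simp: sums_iff)
  finally have fin: "(\<integral>\<^sup>+y. ennreal (F y * w y) \<partial>lebesgue) \<le> ennreal (C * M)" .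
  have wm: "w \<in> borel_measurable lebesgue"
    unfolding w_def by (intro measurable_completion) simp
  have nn: "0 \<le> F y * w y" for y using F(2) by (simp add: w_def)
  show I: "integrable lebesgue (\<lambda>y. F y * w y)"
    using F(1) wm nn fin by (intro integrableI_nonneg) (auto simp: less_top[symmetric] top_unique)
  have "0 \<le> C * M" using M q by (simp add: C_def)
  then show "(LINT y|lebesgue. F y * w y) \<le> C * M"
    using fin nn I by (simp add: nn_integral_eq_integral)
qed

section \<open>Mean oscillation of Morrey functions\<close>

lemma set_integrable_const_ball:
  fixes c :: "'b::{banach,second_countable_topology}"
  shows "set_integrable lebesgue (ball z r) (\<lambda>x::'a::euclidean_space. c)"
  unfolding set_integrable_def
  by (intro integrable_scaleR_left integrable_real_indicator)
    (use emeasure_lborel_ball_finite in \<open>auto simp: less_top[symmetric]\<close>)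

lemma set_lebesgue_integral_const_ball:
  fixes c :: "'b::{banach,second_countable_topology}"
  shows "(LINT x:ball z r|lebesgue. c) = measure lebesgue (ball z r :: 'a::euclidean_space set) *\<^sub>R c"
  using set_integral_const[of "ball z r" lebesgue c] emeasure_lborel_ball_finite[of z r] by simp

lemma set_integral_mono_set:
  fixes F :: "'a \<Rightarrow> real"
  assumes "set_integrable M B F" "A \<in> sets M" "A \<subseteq> B" "\<And>x. 0 \<le> F x"
  shows "(LINT x:A|M. F x) \<le> (LINT x:B|M. F x)"
proof -
  have "set_integrable M A F" using assms by (intro set_integrable_subset[OF assms(1)]) auto
  then show ?thesis
    using assms unfolding set_lebesgue_integral_def set_integrable_def
    by (intro integral_mono) (auto simp: indicator_def)
qed

lemma Lp_loc_diff_powr_ball: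
  fixes f :: "'a::euclidean_space \<Rightarrow> complex"
  assumes "1 \<le> p" "f \<in> Lp_loc p"
  shows "set_integrable lebesgue (ball z r) (\<lambda>x. norm (f x - a) powr p)"
proof -
  have f: "f \<in> borel_measurable lebesgue"
    and i: "set_integrable lebesgue (cball z r) (\<lambda>x. norm (f x) powr p)"
    using assms by (auto simp: Lp_loc_def)
  have "set_integrable lebesgue (ball z r) (\<lambda>x. norm (f x) powr p)"
    by (rule set_integrable_subset[OF i]) auto
  moreover have "set_integrable lebesgue (ball z r) (\<lambda>x. norm a powr p)"
    by (rule set_integrable_const_ball)
  ultimately have "set_integrable lebesgue (ball z r) (\<lambda>x. 2 powr p * (norm (f x) powr p + norm a powr p))"
    by (intro set_integrable_mult_right set_integral_add)
  then show ?thesis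
  proof (rule set_integrable_bound)
    show "set_borel_measurable lebesgue (ball z r) (\<lambda>x. norm (f x - a) powr p)"
      unfolding set_borel_measurable_def using f
      by (intro borel_measurable_scaleR borel_measurable_indicator powr_real_measurable
          borel_measurable_norm borel_measurable_diff borel_measurable_const) auto
    have "norm (f x - a) powr p \<le> 2 powr p * (norm (f x) powr p + norm a powr p)" for x
      using assms by (intro order_trans[OF powr_mono2 powr_add_le] norm_triangle_ineq4) auto
    then show "AE x in lebesgue. x \<in> ball z r \<longrightarrow> norm (norm (f x - a) powr p)
        \<le> norm (2 powr p * (norm (f x) powr p + norm a powr p))"
      by simp
  qed
qed

text \<open>Local integrability follows from \<open>le_add_powr\<close> with \<open>d = 1\<close>,
  since constants are integrable on balls.\<close>

lemma Lp_loc_ball: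
  fixes f :: "'a::euclidean_space \<Rightarrow> complex"
  assumes "1 \<le> p" "f \<in> Lp_loc p"
  shows "set_integrable lebesgue (ball z r) f"
proof -
  have "set_integrable lebesgue (ball z r) (\<lambda>x. 1 + norm (f x - 0) powr p)"
    using assms
    by (intro set_integral_add set_integrable_const_ball Lp_loc_diff_powr_ball)
  then show ?thesis
  proof (rule set_integrable_bound)
    show "set_borel_measurable lebesgue (ball z r) f"
      unfolding set_borel_measurable_def using assms(2)
      by (intro borel_measurable_scaleR borel_measurable_indicator) (auto simp: Lp_loc_def)
    show "AE x in lebesgue. x \<in> ball z r \<longrightarrow> norm (f x) \<le> norm (1 + norm (f x - 0) powr p)"
      using le_add_powr[of p "norm (f _)" 1] assms(1) by simp
  qed
qed

text \<open>The left side is at most the mean of \<open>norm (f x - a)\<close>, to which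
  \<open>le_add_powr\<close> applies pointwise. The parameter \<open>d\<close> stays free so that it
  can later be matched to the Morrey scale.\<close>

lemma ball_mean_diff_le:
  fixes f :: "'a::euclidean_space \<Rightarrow> complex"
  assumes p: "1 \<le> p" and f: "f \<in> Lp_loc p" and "0 < r" "0 < d"
  shows "norm (ball_mean f z r - a) \<le> d + d powr (1 - p) *
     (LINT x:ball z r|lebesgue. norm (f x - a) powr p) / (unit_ball_vol DIM('a) * r powr DIM('a))"
proof -
  define v where "v = measure lebesgue (ball z r)"
  have v: "v = unit_ball_vol DIM('a) * r powr DIM('a)"
    using \<open>0 < r\<close> by (simp add: v_def content_ball powr_realpow)
  have v0: "0 < v" unfolding v using \<open>0 < r\<close> by simp
  have c: "set_integrable lebesgue (ball z r) (\<lambda>x. c)" for c :: "'b::{banach,second_countable_topology}"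
    by (rule set_integrable_const_ball)
  have lc: "(LINT x:ball z r|lebesgue. c) = v *\<^sub>R c" for c :: "'b::{banach,second_countable_topology}"
    unfolding v_def by (rule set_lebesgue_integral_const_ball)
  have fi: "set_integrable lebesgue (ball z r) f" by (rule Lp_loc_ball[OF p f])
  then have fa: "set_integrable lebesgue (ball z r) (\<lambda>x. f x - a)"
    using c by (rule set_integral_diff)
  have F: "set_integrable lebesgue (ball z r) (\<lambda>x. d powr (1 - p) * norm (f x - a) powr p)"
    by (intro set_integrable_mult_right Lp_loc_diff_powr_ball p f)
  have "ball_mean f z r - a = (LINT x:ball z r|lebesgue. f x - a) /\<^sub>R v"
    using fi c v0 by (simp add: ball_mean_def set_integral_diff lc scaleR_diff_right v_def)
  then have "norm (ball_mean f z r - a) = norm (LINT x:ball z r|lebesgue. f x - a) / v"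
    using v0 by (simp add: field_simps)
  also have "\<dots> \<le> (LINT x:ball z r|lebesgue. d + d powr (1 - p) * norm (f x - a) powr p) / v"
  proof (intro divide_right_mono)
    have "norm (LINT x:ball z r|lebesgue. f x - a) \<le> (LINT x:ball z r|lebesgue. norm (f x - a))"
      by (rule set_integral_norm_bound[OF fa])
    also have "\<dots> \<le> (LINT x:ball z r|lebesgue. d + d powr (1 - p) * norm (f x - a) powr p)"
      using le_add_powr[OF p _ \<open>0 < d\<close>]
      by (intro set_integral_mono set_integrable_norm fa set_integral_add c F) auto
    finally show "norm (LINT x:ball z r|lebesgue. f x - a) \<le> \<dots>" .
  qed (use v0 in simp)
  also have "\<dots> = d + d powr (1 - p) * (LINT x:ball z r|lebesgue. norm (f x - a) powr p) / v"
    using v0 by (simp add: set_integral_add(2)[OF c F] lc add_divide_distrib)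
  finally show ?thesis by (simp add: v)
qed

text \<open>The numerator is the cost of one doubling of the radius; the denominator sums the
  geometric series over all doublings.\<close>

definition mean_const :: "real \<Rightarrow> real \<Rightarrow> real \<Rightarrow> real" where
  "mean_const n p lam = (1 + 2 powr lam / unit_ball_vol n) / (1 - 2 powr ((lam - n) / p))"

text \<open>The summand 1 accounts for the oscillation on the large ball, the other one for the
  drift of the means times the volume of the ball.\<close>

definition osc_const :: "real \<Rightarrow> real \<Rightarrow> real \<Rightarrow> real" where
  "osc_const n p lam = 2 powr p * (1 + mean_const n p lam powr p * unit_ball_vol n)"

text \<open>\<open>N\<close> is a positive majorant for the Morrey norm, not the norm itself: the
  scale \<open>d = N * r powr s\<close> must be positive in \<open>le_add_powr\<close>, also when
  the norm is 0.\<close>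

locale morrey_function =
  fixes f :: "'a::euclidean_space \<Rightarrow> complex" and n p lam N :: real
  assumes n: "n = real DIM('a)"
    and p: "1 \<le> p" and lam: "0 < lam" "lam < n" and N: "0 < N"
    and f: "f \<in> Lp_loc p"
    and osc: "\<And>z r. 0 < r \<Longrightarrow>
      (LINT x:ball z r|lebesgue. norm (f x - ball_mean f z r) powr p) \<le> N powr p * r powr lam"
begin

abbreviation (input) "V \<equiv> unit_ball_vol n"
abbreviation (input) "s \<equiv> (lam - n) / p"
abbreviation (input) "D \<equiv> mean_const n p lam"
abbreviation (input) "C \<equiv> osc_const n p lam"

lemma s_neg: "s < 0" using p lam by (simp add: divide_neg_pos)

lemma V_pos: "0 < V" by (simp add: n)

lemma D_nonneg: "0 \<le> D"
  unfolding mean_const_def using s_neg V_pos by (intro divide_nonneg_nonneg) (auto simp: powr_less_one less_imp_le)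

lemma C_pos: "0 < C"
  unfolding osc_const_def using D_nonneg V_pos by (intro mult_pos_pos add_pos_nonneg) auto

text \<open>\<open>ball_mean_diff_le\<close> on the small ball, with \<open>a\<close> the mean over
  the double ball; the integral is then enlarged to the double ball, where \<open>osc\<close>
  applies.\<close>

lemma ball_mean_double:
  assumes r: "0 < r"
  shows "norm (ball_mean f z (2 * r) - ball_mean f z r) \<le> (1 + 2 powr lam / V) * N * r powr s"
proof -
  define d where "d = N * r powr s"
  have d: "0 < d" using N r by (simp add: d_def)
  let ?F = "\<lambda>x. norm (f x - ball_mean f z (2 * r)) powr p"
  have "(LINT x:ball z r|lebesgue. ?F x) \<le> (LINT x:ball z (2 * r)|lebesgue. ?F x)"
    using r by (intro set_integral_mono_set Lp_loc_diff_powr_ball p f) (auto simp: less_imp_le)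
  also have "\<dots> \<le> N powr p * (2 * r) powr lam" using r by (intro osc) simp
  finally have le: "(LINT x:ball z r|lebesgue. ?F x) \<le> N powr p * (2 * r) powr lam" .
  have "norm (ball_mean f z r - ball_mean f z (2 * r)) \<le>
      d + d powr (1 - p) * (LINT x:ball z r|lebesgue. ?F x) / (V * r powr n)"
    unfolding n by (rule ball_mean_diff_le[OF p f r d])
  also have "\<dots> \<le> d + d powr (1 - p) * (N powr p * (2 * r) powr lam) / (V * r powr n)"
    using le r V_pos by (intro add_left_mono divide_right_mono mult_left_mono) auto
  also have "d powr (1 - p) * (N powr p * (2 * r) powr lam) / (V * r powr n) =
      2 powr lam / V * ((N powr (1 - p) * N powr p) * (r powr (s * (1 - p)) * r powr lam / r powr n))"
    using N r by (simp add: d_def powr_mult powr_powr)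
  also have "N powr (1 - p) * N powr p = N"
    using N by (simp add: powr_add[symmetric])
  also have "r powr (s * (1 - p)) * r powr lam / r powr n = r powr (s * (1 - p) + lam - n)"
    using r by (simp add: powr_add powr_diff)
  \<comment> \<open>This is \<open>lam - n = s * p\<close>: with this choice of \<open>d\<close>
    both terms scale alike.\<close>
  also have "s * (1 - p) + lam - n = s"
    using p by (simp add: field_simps)
  finally show ?thesis by (simp add: d_def algebra_simps norm_minus_commute)
qed

text \<open>The doublings telescope, and because \<open>lam < n\<close> makes \<open>s\<close>
  negative, their costs decrease geometrically; hence the bound is uniform in
  \<open>k\<close>.\<close>

lemma ball_mean_dyadic:
  assumes r: "0 < r"
  shows "norm (ball_mean f z (2 ^ k * r) - ball_mean f z r) \<le> D * N * r powr s"
proof -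
  define q where "q = 2 powr s"
  define A where "A = (1 + 2 powr lam / V) * N * r powr s"
  have q: "0 < q" "q < 1" using s_neg by (auto simp: q_def powr_less_one)
  have A: "0 \<le> A" using V_pos N by (simp add: A_def)
  have "norm (ball_mean f z (2 ^ k * r) - ball_mean f z r) \<le> A * (\<Sum>j<k. q ^ j)"
  proof (induction k)
    case (Suc k)
    have "norm (ball_mean f z (2 * (2 ^ k * r)) - ball_mean f z (2 ^ k * r))
        \<le> (1 + 2 powr lam / V) * N * (2 ^ k * r) powr s"
      using r by (intro ball_mean_double) simp
    also have "(2 ^ k * r) powr s = q ^ k * r powr s"
      using r by (simp add: powr_mult q_def powr_realpow[symmetric] powr_powr mult.commute)
    also have "(1 + 2 powr lam / V) * N * (q ^ k * r powr s) = A * q ^ k"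
      by (simp add: A_def)
    finally have "norm (ball_mean f z (2 ^ Suc k * r) - ball_mean f z (2 ^ k * r)) \<le> A * q ^ k"
      by (simp add: mult.assoc)
    with Suc have "norm ((ball_mean f z (2 ^ Suc k * r) - ball_mean f z (2 ^ k * r)) +
        (ball_mean f z (2 ^ k * r) - ball_mean f z r)) \<le> A * q ^ k + A * (\<Sum>j<k. q ^ j)"
      by (intro norm_triangle_le) linarith
    then show ?case by (simp add: algebra_simps)
  qed simp
  also have "\<dots> \<le> A * (1 / (1 - q))"
  proof (intro mult_left_mono A)
    show "(\<Sum>j<k. q ^ j) \<le> 1 / (1 - q)"
      using q by (simp add: sum_gp_strict divide_right_mono)
  qed
  also have "\<dots> = D * N * r powr s"
    by (simp add: A_def mean_const_def q_def)
  finally show ?thesis .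
qed

text \<open>The mean over the small ball is exchanged for the mean over the large one, at the price
  of a constant \<open>d\<close>. This supplies the growth hypothesis of
  \<open>dyadic_weight\<close>.\<close>

lemma dyadic_osc:
  assumes r: "0 < r"
  shows "(LINT x:ball z (2 ^ k * r)|lebesgue. norm (f x - ball_mean f z r) powr p)
    \<le> C * N powr p * r powr lam * 2 powr (real k * n)"
proof -
  define R where "R = 2 ^ k * r"
  define d where "d = D * N * r powr s"
  have R: "0 < R" "R = 2 powr real k * r" using r by (auto simp: R_def powr_realpow)
  have d: "0 \<le> d" using D_nonneg N by (simp add: d_def)
  let ?F = "\<lambda>x. norm (f x - ball_mean f z R) powr p"
  have c: "set_integrable lebesgue (ball z R) (\<lambda>x. c)" for c :: real
    by (rule set_integrable_const_ball)
  have lc: "(LINT x:ball z R|lebesgue. c) = V * R powr n * c" for c :: real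
    using R by (simp add: set_lebesgue_integral_const_ball content_ball powr_realpow n)
  have F: "set_integrable lebesgue (ball z R) ?F"
    by (intro Lp_loc_diff_powr_ball p f)
  have le: "norm (f x - ball_mean f z r) powr p \<le> 2 powr p * (?F x + d powr p)" for x
  proof -
    have "norm (f x - ball_mean f z r) \<le> norm (f x - ball_mean f z R) + d"
      using ball_mean_dyadic[OF r, of z k]
        norm_triangle_ineq[of "f x - ball_mean f z R" "ball_mean f z R - ball_mean f z r"]
      by (simp add: R_def d_def)
    then have "norm (f x - ball_mean f z r) powr p \<le> (norm (f x - ball_mean f z R) + d) powr p"
      using p by (intro powr_mono2) auto
    also have "\<dots> \<le> 2 powr p * (?F x + d powr p)"
      using p d by (intro powr_add_le) auto
    finally show ?thesis .
  qed
  have "(LINT x:ball z R|lebesgue. norm (f x - ball_mean f z r) powr p)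
      \<le> (LINT x:ball z R|lebesgue. 2 powr p * (?F x + d powr p))"
    by (intro set_integral_mono Lp_loc_diff_powr_ball p f set_integrable_mult_right
        set_integral_add(1) F c le)
  also have "\<dots> = 2 powr p * ((LINT x:ball z R|lebesgue. ?F x) + V * R powr n * d powr p)"
    by (simp add: set_integral_add(2)[OF F c] lc)
  also have "\<dots> \<le> 2 powr p * (N powr p * R powr lam + V * R powr n * d powr p)"
    by (intro mult_left_mono add_right_mono osc R) simp
  also have "V * R powr n * d powr p = V * (R powr n * d powr p)" by simp
  also have "R powr n * d powr p = D powr p * N powr p * (r powr n * r powr (s * p)) * 2 powr (real k * n)"
    using D_nonneg N r by (simp add: R(2) d_def powr_mult powr_powr)
  also have "r powr n * r powr (s * p) = r powr lam"
    using p r by (simp add: powr_add[symmetric])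
  finally have le': "(LINT x:ball z R|lebesgue. norm (f x - ball_mean f z r) powr p) \<le>
      2 powr p * (N powr p * R powr lam + V * (D powr p * N powr p * r powr lam * 2 powr (real k * n)))" .
  \<comment> \<open>The oscillation term grows only like \<open>2 powr (k lam)\<close>; it is
    weakened to the growth rate of the volume term.\<close>
  have "R powr lam \<le> 2 powr (real k * n) * r powr lam"
    using lam r by (simp add: R(2) powr_mult powr_powr mult_left_mono)
  then have "2 powr p * (N powr p * R powr lam + V * (D powr p * N powr p * r powr lam * 2 powr (real k * n)))
      \<le> 2 powr p * (N powr p * (2 powr (real k * n) * r powr lam)
        + V * (D powr p * N powr p * r powr lam * 2 powr (real k * n)))"
    by (intro mult_left_mono add_right_mono) auto
  also have "\<dots> = C * N powr p * r powr lam * 2 powr (real k * n)"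
    by (simp add: osc_const_def algebra_simps)
  finally show ?thesis using le' by (simp add: R_def)
qed

end

section \<open>Integrals against power weights\<close>

definition weight_const :: "real \<Rightarrow> real \<Rightarrow> real" where
  "weight_const n \<beta> = 2 powr (n + \<beta>) / (1 - 2 powr (- \<beta>))"

text \<open>\<open>dyadic_weight\<close> for \<open>F = 1\<close>, with \<open>M\<close> the volume
  of the ball of radius \<open>r\<close>.\<close>

lemma weight_integral:
  fixes z :: "'a::euclidean_space"
  assumes r: "0 < r" and \<beta>: "0 < \<beta>"
  shows "integrable lebesgue (\<lambda>y. (1 + norm (y - z) / r) powr (- (real DIM('a) + \<beta>)))"
    and "(LINT y|lebesgue. (1 + norm (y - z) / r) powr (- (real DIM('a) + \<beta>)))
      \<le> 2 powr (real DIM('a) + \<beta>) / (1 - 2 powr (- \<beta>)) * (unit_ball_vol DIM('a) * r powr DIM('a))"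
proof -
  have "(LINT y:ball z (2 ^ k * r)|lebesgue. 1) \<le>
      unit_ball_vol DIM('a) * r powr DIM('a) * 2 powr (real k * real DIM('a))" for k
    using r by (simp add: set_lebesgue_integral_const_ball content_ball power_mult_distrib
        power_mult[symmetric] powr_realpow[symmetric] powr_powr)
  note * = dyadic_weight[OF _ _ set_integrable_const_ball this r \<beta>, simplified]
  show "integrable lebesgue (\<lambda>y. (1 + norm (y - z) / r) powr (- (real DIM('a) + \<beta>)))"
    using *(1) by simp
  show "(LINT y|lebesgue. (1 + norm (y - z) / r) powr (- (real DIM('a) + \<beta>)))
      \<le> 2 powr (real DIM('a) + \<beta>) / (1 - 2 powr (- \<beta>)) * (unit_ball_vol DIM('a) * r powr DIM('a))"
    using *(2) by simp
qed

context morrey_function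
begin

lemma f_measurable: "f \<in> borel_measurable lebesgue"
  using f by (simp add: Lp_loc_def)

lemma osc_measurable: "(\<lambda>x. norm (f x - a)) \<in> borel_measurable lebesgue"
  by (rule measurable_compose[OF borel_measurable_diff[OF f_measurable borel_measurable_const]
        borel_measurable_norm])

lemma osc_powr_measurable: "(\<lambda>x. norm (f x - a) powr p) \<in> borel_measurable lebesgue"
  by (intro powr_real_measurable osc_measurable borel_measurable_const)

lemma weight_measurable:
  "(\<lambda>y::'a. (1 + norm (y - z) / r) powr q) \<in> borel_measurable lebesgue"
  by (intro measurable_completion) simp

lemma weighted_osc_powr:
  assumes "0 < r" "0 < \<beta>"
  shows "integrable lebesgue (\<lambda>y. norm (f y - ball_mean f z r) powr p *
      (1 + norm (y - z) / r) powr (- (n + \<beta>)))"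
    and "(LINT y|lebesgue. norm (f y - ball_mean f z r) powr p *
      (1 + norm (y - z) / r) powr (- (n + \<beta>))) \<le> weight_const n \<beta> * (C * N powr p * r powr lam)"
  by (rule dyadic_weight[where ?'a = 'a and z = z and r = r and \<beta> = \<beta>, folded n weight_const_def,
        OF osc_powr_measurable _ Lp_loc_diff_powr_ball[OF p f] dyadic_osc[OF \<open>0 < r\<close>] assms]; simp)+

text \<open>The passage from the \<open>p\<close>-th to the first power: \<open>le_add_powr\<close>
  at \<open>d = N * r powr s\<close> is integrated against the weight, and both resulting terms are
  of size \<open>N * r powr (s + n)\<close>.\<close>

lemma weighted_osc:
  assumes r: "0 < r" and \<beta>: "0 < \<beta>"
  shows "integrable lebesgue (\<lambda>y. norm (f y - ball_mean f z r) *
      (1 + norm (y - z) / r) powr (- (n + \<beta>)))"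
    and "(LINT y|lebesgue. norm (f y - ball_mean f z r) *
      (1 + norm (y - z) / r) powr (- (n + \<beta>))) \<le> weight_const n \<beta> * (V + C) * N * r powr s * r powr n"
proof -
  define w where "w y = (1 + norm (y - z) / r) powr (- (n + \<beta>))" for y :: 'a
  define d where "d = N * r powr s"
  let ?F = "\<lambda>y. norm (f y - ball_mean f z r)"
  have d: "0 < d" using N r by (simp add: d_def)
  have w0: "0 \<le> w y" for y by (simp add: w_def)
  have i: "integrable lebesgue (\<lambda>y. ?F y powr p * w y)"
    "(LINT y|lebesgue. ?F y powr p * w y) \<le> weight_const n \<beta> * (C * N powr p * r powr lam)"
    unfolding w_def by (rule weighted_osc_powr[OF assms])+
  have j: "integrable lebesgue w" "(LINT y|lebesgue. w y) \<le> weight_const n \<beta> * (V * r powr n)"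
    unfolding w_def by (rule weight_integral[of r \<beta> z, folded n weight_const_def, OF assms])+
  have B: "integrable lebesgue (\<lambda>y. d * w y + d powr (1 - p) * (?F y powr p * w y))"
    using i(1) j(1) by simp
  have le: "?F y * w y \<le> d * w y + d powr (1 - p) * (?F y powr p * w y)" for y
    using mult_right_mono[OF le_add_powr[OF p _ d, of "?F y"] w0[of y]] by (simp add: algebra_simps)
  have I: "integrable lebesgue (\<lambda>y. ?F y * w y)"
  proof (rule Bochner_Integration.integrable_bound[OF B])
    show "(\<lambda>y. ?F y * w y) \<in> borel_measurable lebesgue"
      unfolding w_def by (intro borel_measurable_times osc_measurable weight_measurable)
    show "AE y in lebesgue. norm (?F y * w y) \<le> norm (d * w y + d powr (1 - p) * (?F y powr p * w y))"
      using le w0 by (auto intro!: AE_I2 order_trans[OF le] simp: abs_mult)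
  qed
  then show "integrable lebesgue (\<lambda>y. ?F y * (1 + norm (y - z) / r) powr (- (n + \<beta>)))"
    by (simp add: w_def)
  have "(LINT y|lebesgue. ?F y * w y) \<le>
      (LINT y|lebesgue. d * w y + d powr (1 - p) * (?F y powr p * w y))"
    by (intro integral_mono I B le)
  also have "\<dots> = d * (LINT y|lebesgue. w y) + d powr (1 - p) * (LINT y|lebesgue. ?F y powr p * w y)"
    using i(1) j(1) by simp
  also have "\<dots> \<le> d * (weight_const n \<beta> * (V * r powr n)) +
      d powr (1 - p) * (weight_const n \<beta> * (C * N powr p * r powr lam))"
    using d i(2) j(2) by (intro add_mono mult_left_mono) auto
  also have "d powr (1 - p) * (weight_const n \<beta> * (C * N powr p * r powr lam)) =
      weight_const n \<beta> * C * (N powr (1 - p) * N powr p) * (r powr (s * (1 - p)) * r powr lam)"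
    using N r by (simp add: d_def powr_mult powr_powr)
  also have "N powr (1 - p) * N powr p = N"
    using N by (simp add: powr_add[symmetric])
  also have "r powr (s * (1 - p)) * r powr lam = r powr (s * (1 - p) + lam)"
    by (simp add: powr_add)
  also have "s * (1 - p) + lam = s + n"
    using p by (simp add: field_simps)
  finally show "(LINT y|lebesgue. ?F y * (1 + norm (y - z) / r) powr (- (n + \<beta>)))
      \<le> weight_const n \<beta> * (V + C) * N * r powr s * r powr n"
    by (simp add: w_def d_def powr_add algebra_simps)
qed

text \<open>The unit ball at the origin turns the weight of \<open>weighted_osc_powr\<close> into
  that of \<open>M_class\<close>; the mean \<open>a\<close> is added back because the weight itself
  is integrable.\<close>

lemma mem_M_class:
  assumes \<beta>: "0 < \<beta>"
  shows "f \<in> M_class p \<beta>"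
proof -
  define w where "w y = (1 + norm y) powr (- (n + \<beta>))" for y :: 'a
  define a where "a = ball_mean f 0 1"
  have w0: "0 \<le> w y" for y by (simp add: w_def)
  have i: "integrable lebesgue (\<lambda>y. norm (f y - a) powr p * w y)"
    using weighted_osc_powr(1)[of 1 \<beta> 0] \<beta> by (simp add: w_def a_def)
  have j: "integrable lebesgue w"
    using weight_integral(1)[of 1 \<beta> "0::'a"] \<beta> by (simp add: w_def[abs_def] n)
  have "integrable lebesgue (\<lambda>y. 2 powr p * (norm (f y - a) powr p * w y + norm a powr p * w y))"
    using i j by simp
  then have "integrable lebesgue (\<lambda>y. norm (f y) powr p * w y)"
  proof (rule Bochner_Integration.integrable_bound)
    show "(\<lambda>y. norm (f y) powr p * w y) \<in> borel_measurable lebesgue"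
      using osc_powr_measurable[of 0] weight_measurable[of 0 1]
      unfolding w_def by (intro borel_measurable_times) auto
    have le: "norm (f y) powr p * w y
        \<le> 2 powr p * (norm (f y - a) powr p * w y + norm a powr p * w y)" for y
    proof -
      have "norm (f y) powr p \<le> (norm (f y - a) + norm a) powr p"
        using p norm_triangle_ineq[of "f y - a" a] by (intro powr_mono2) auto
      also have "\<dots> \<le> 2 powr p * (norm (f y - a) powr p + norm a powr p)"
        using p by (intro powr_add_le) auto
      finally show ?thesis using mult_right_mono[OF _ w0[of y]] by (fastforce simp: algebra_simps)
    qed
    show "AE y in lebesgue. norm (norm (f y) powr p * w y)
        \<le> norm (2 powr p * (norm (f y - a) powr p * w y + norm a powr p * w y))"
      using w0 by (auto intro!: AE_I2 order_trans[OF le] simp: abs_mult)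
  qed
  then show ?thesis using f by (simp add: M_class_def w_def n)
qed

text \<open>With \<open>b\<close> the mean of \<open>f\<close>, the integrand splits into
  \<open>\<kappa> y * (f y - b)\<close> and \<open>\<kappa> y * b\<close>. If
  \<open>\<kappa>\<close> has mass 1, the second part integrates to \<open>b\<close>, so only the
  oscillation meets the kernel. In the application \<open>\<kappa>\<close> is a section
  \<open>k t x\<close> and \<open>a\<close> is \<open>f x\<close>.\<close>

lemma kernel_integral:
  fixes \<kappa> :: "'a \<Rightarrow> complex"
  assumes r: "0 < r" and \<beta>: "0 < \<beta>" and \<kappa>: "\<kappa> \<in> borel_measurable lebesgue"
    and le: "\<And>y. norm (\<kappa> y) \<le> A * (1 + norm (y - z) / r) powr (- (n + \<beta>))"
  shows "integrable lebesgue (\<lambda>y. \<kappa> y * f y)"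
    and "(LINT y|lebesgue. \<kappa> y) = 1 \<Longrightarrow> norm (a - (LINT y|lebesgue. \<kappa> y * f y))
      \<le> norm (a - ball_mean f z r) + A * weight_const n \<beta> * (V + C) * N * r powr s * r powr n"
proof -
  define w where "w y = (1 + norm (y - z) / r) powr (- (n + \<beta>))" for y :: 'a
  define b where "b = ball_mean f z r"
  have w0: "0 \<le> w y" for y by (simp add: w_def)
  \<comment> \<open>At \<open>y = z\<close> the weight equals 1.\<close>
  have A: "0 \<le> A" using order_trans[OF norm_ge_zero le[of z]] by simp
  have j: "integrable lebesgue w"
    unfolding w_def n by (rule weight_integral[OF r \<beta>])
  have i: "integrable lebesgue (\<lambda>y. norm (f y - b) * w y)"
    "(LINT y|lebesgue. norm (f y - b) * w y) \<le> weight_const n \<beta> * (V + C) * N * r powr s * r powr n"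
    unfolding w_def b_def by (rule weighted_osc[OF r \<beta>])+
  have le': "norm (\<kappa> y) \<le> A * w y" for y using le by (simp add: w_def)
  have \<kappa>i: "integrable lebesgue \<kappa>"
    using A w0 by (intro Bochner_Integration.integrable_bound[OF integrable_mult_right[OF j, of A]] \<kappa>)
      (auto intro!: AE_I2 le' simp: abs_mult)
  have le2: "norm (\<kappa> y * (f y - b)) \<le> A * (norm (f y - b) * w y)" for y
    using mult_right_mono[OF le'[of y], of "norm (f y - b)"] by (simp add: norm_mult mult_ac)
  have oi: "integrable lebesgue (\<lambda>y. \<kappa> y * (f y - b))"
    using A w0 by (intro Bochner_Integration.integrable_bound[OF integrable_mult_right[OF i(1), of A]]
        borel_measurable_times borel_measurable_diff borel_measurable_const \<kappa> f_measurable)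
      (auto intro!: AE_I2 order_trans[OF le2] simp: abs_mult)
  have eq: "\<kappa> y * f y = \<kappa> y * (f y - b) + \<kappa> y * b" for y by (simp add: algebra_simps)
  show "integrable lebesgue (\<lambda>y. \<kappa> y * f y)"
    unfolding eq using oi \<kappa>i by simp
  assume 1: "(LINT y|lebesgue. \<kappa> y) = 1"
  have "(LINT y|lebesgue. \<kappa> y * f y) = (LINT y|lebesgue. \<kappa> y * (f y - b)) + b"
    unfolding eq using oi \<kappa>i by (simp add: 1)
  then have "norm (a - (LINT y|lebesgue. \<kappa> y * f y)) \<le>
      norm (a - b) + norm (LINT y|lebesgue. \<kappa> y * (f y - b))"
    using norm_triangle_ineq4[of "a - b" "LINT y|lebesgue. \<kappa> y * (f y - b)"] by (simp add: algebra_simps)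
  also have "norm (LINT y|lebesgue. \<kappa> y * (f y - b)) \<le> (LINT y|lebesgue. A * (norm (f y - b) * w y))"
    using le2 i(1) by (intro order_trans[OF integral_norm_bound] integral_mono integrable_norm oi) auto
  also have "\<dots> \<le> A * (weight_const n \<beta> * (V + C) * N * r powr s * r powr n)"
    using i A by (simp add: mult_left_mono)
  finally show "norm (a - (LINT y|lebesgue. \<kappa> y * f y))
      \<le> norm (a - ball_mean f z r) + A * weight_const n \<beta> * (V + C) * N * r powr s * r powr n"
    by (simp add: b_def mult.assoc)
qed

end

section \<open>Heat kernels\<close>

lemma lebesgue_measurable_ex_borel:
  fixes f :: "'a::euclidean_space \<Rightarrow> complex"
  assumes "f \<in> borel_measurable lebesgue"
  obtains f' where "f' \<in> borel_measurable borel" "AE x in lborel. f x = f' x"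
proof -
  have "(\<lambda>x. Re (f x)) \<in> borel_measurable lebesgue" "(\<lambda>x. Im (f x)) \<in> borel_measurable lebesgue"
    by (rule measurable_compose[OF assms], simp)+
  from this[THEN completion_ex_borel_measurable_real] obtain u v where
    uv: "u \<in> borel_measurable lborel" "v \<in> borel_measurable lborel"
    "AE x in lborel. Re (f x) = u x" "AE x in lborel. Im (f x) = v x" by blast
  show thesis
  proof (rule that[of "\<lambda>x. Complex (u x) (v x)"])
    show "(\<lambda>x. Complex (u x) (v x)) \<in> borel_measurable borel"
      using uv(1,2) by (simp add: borel_measurable_complex_iff)
    show "AE x in lborel. f x = Complex (u x) (v x)"
      using uv(3,4) by eventually_elim (simp add: complex_eq_iff)
  qed
qed

text \<open>
  Measurability for the completed product measure does not pass to sections, so one works with Borel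
  versions of the kernel and of the function.
\<close>
lemma kernel_op_measurable:
  fixes k :: "real \<Rightarrow> 'a::euclidean_space \<Rightarrow> 'a \<Rightarrow> complex"
  assumes k: "(\<lambda>(x, y). k t x y) \<in> borel_measurable lebesgue"
    and f: "f \<in> borel_measurable lebesgue"
  shows "kernel_op k t f \<in> borel_measurable lebesgue"
    and "AE x in lebesgue. k t x \<in> borel_measurable lebesgue"
proof -
  obtain k' where k'm: "k' \<in> borel_measurable (borel :: ('a \<times> 'a) measure)"
    and k': "AE z in lborel. (\<lambda>(x, y). k t x y) z = k' z"
    using lebesgue_measurable_ex_borel[OF k] .
  obtain f' where f'm: "f' \<in> borel_measurable borel" and f': "AE x in lborel. f x = f' x"
    using lebesgue_measurable_ex_borel[OF f] .
  have "AE z in (lborel :: 'a measure) \<Otimes>\<^sub>M (lborel :: 'a measure). (\<lambda>(x, y). k t x y) z = k' z"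
    unfolding lborel_prod by (rule k')
  \<comment> \<open>Almost all sections of a null set in the product are null.\<close>
  from lborel_pair.AE_pair[OF this] have *: "AE x in lebesgue. AE y in lebesgue. k t x y = k' (x, y)"
    by (simp add: AE_completion_iff)
  have [measurable]: "k' \<in> borel_measurable (borel \<Otimes>\<^sub>M borel)" "f' \<in> borel_measurable borel"
    using k'm f'm by (simp_all add: borel_prod)
  have k'x: "(\<lambda>y. k' (x, y)) \<in> borel_measurable lebesgue" for x
    by (intro measurable_completion) simp
  from * show "AE x in lebesgue. k t x \<in> borel_measurable lebesgue"
  proof eventually_elim
    case (elim x)
    then have "AE y in lebesgue. k' (x, y) = k t x y" by eventually_elim simp
    with k'x show ?case by (rule borel_measurable_AE)
  qed
  then have "AE x in lebesgue. (LINT y|lborel. k' (x, y) * f' y) = kernel_op k t f x"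
    using *
  proof eventually_elim
    case (elim x)
    have "(LINT y|lborel. k' (x, y) * f' y) = (LINT y|lebesgue. k' (x, y) * f' y)"
      by (rule integral_completion[symmetric]) simp
    also have "\<dots> = (LINT y|lebesgue. k t x y * f y)"
    proof (rule integral_cong_AE)
      show "(\<lambda>y. k' (x, y) * f' y) \<in> borel_measurable lebesgue"
        by (intro measurable_completion) simp
      show "(\<lambda>y. k t x y * f y) \<in> borel_measurable lebesgue"
        by (intro borel_measurable_times elim f)
      have "AE y in lebesgue. f y = f' y" using f' by (simp add: AE_completion_iff)
      then show "AE y in lebesgue. k' (x, y) * f' y = k t x y * f y"
        using elim(2) by eventually_elim simp
    qed
    finally show ?case by (simp add: kernel_op_def)
  qed
  moreover have "(\<lambda>x. LINT y|lborel. k' (x, y) * f' y) \<in> borel_measurable lebesgue"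
    by (intro measurable_completion) simp
  \<comment> \<open>Completeness of Lebesgue measure transfers measurability to a function that
    agrees almost everywhere.\<close>
  ultimately show "kernel_op k t f \<in> borel_measurable lebesgue"
    by (intro borel_measurable_AE[of "\<lambda>x. LINT y|lborel. k' (x, y) * f' y" "kernel_op k t f"])
qed

text \<open>The limit controls \<open>g\<close> beyond some radius \<open>R\<close>, boundedness
  controls it before; the constant adds the two contributions.\<close>

lemma admissible_profile_decay:
  assumes "admissible_profile d g"
  obtains A \<beta> where "0 \<le> A" "0 < \<beta>" "\<And>u. 0 \<le> u \<Longrightarrow> g u \<le> A * (1 + u) powr (- (real d + \<beta>))"
proof -
  obtain \<beta> where \<beta>: "0 < \<beta>" "((\<lambda>r. r powr (real d + \<beta>) * g r) \<longlongrightarrow> 0) at_top"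
    using assms by (auto simp: admissible_profile_def)
  define q where "q = real d + \<beta>"
  have q: "0 < q" using \<beta> by (simp add: q_def)
  have "\<forall>\<^sub>F r in at_top. r powr q * g r < 1"
    using order_tendstoD(2)[OF \<beta>(2), of 1] by (simp add: q_def)
  then obtain R0 where R0: "\<And>r. R0 \<le> r \<Longrightarrow> r powr q * g r < 1"
    by (auto simp: eventually_at_top_linorder)
  \<comment> \<open>\<open>R \<ge> 1\<close> ensures \<open>u \<ge> (1 + u) / 2\<close> for
    \<open>u \<ge> R\<close>, which allows replacing \<open>u\<close> by
    \<open>1 + u\<close>.\<close>
  define R where "R = max 1 R0"
  have R: "1 \<le> R" "\<And>r. R \<le> r \<Longrightarrow> r powr q * g r < 1" using R0 by (auto simp: R_def)
  obtain M where M: "\<And>u. 0 \<le> u \<Longrightarrow> \<bar>g u\<bar> \<le> M"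
    using assms by (auto simp: admissible_profile_def bounded_iff)
  have M0: "0 \<le> M" using M[of 0] by simp
  show thesis
  proof (rule that[of "2 powr q + M * (1 + R) powr q" \<beta>])
    fix u :: real assume u: "0 \<le> u"
    have "g u \<le> (2 powr q + M * (1 + R) powr q) * (1 + u) powr (- q)"
    proof (cases "R \<le> u")
      case True
      then have "g u \<le> u powr (- q)"
        using R(2)[of u] R(1) by (simp add: powr_minus field_simps)
      also have "\<dots> \<le> ((1 + u) / 2) powr (- q)"
        using True R(1) q by (intro powr_mono2') auto
      also have "\<dots> = 2 powr q * (1 + u) powr (- q)"
        using u by (simp add: powr_divide powr_minus field_simps)
      also have "\<dots> \<le> (2 powr q + M * (1 + R) powr q) * (1 + u) powr (- q)"
        using M0 by (intro mult_right_mono) auto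
      finally show ?thesis .
    next
      case False
      have "g u \<le> M * 1" using M[OF u] by simp
      also have "1 \<le> (1 + R) powr q * (1 + u) powr (- q)"
        using False u q R(1) powr_mono2[of q "1 + u" "1 + R"] by (simp add: powr_minus field_simps)
      then have "M * 1 \<le> M * ((1 + R) powr q * (1 + u) powr (- q))"
        by (rule mult_left_mono) (rule M0)
      also have "\<dots> \<le> (2 powr q + M * (1 + R) powr q) * (1 + u) powr (- q)"
        by (simp add: distrib_right)
      finally show ?thesis .
    qed
    then show "g u \<le> (2 powr q + M * (1 + R) powr q) * (1 + u) powr (- (real d + \<beta>))"
      by (simp add: q_def)
  qed (use M0 \<beta> in auto)
qed

text \<open>The time \<open>r powr m\<close> makes \<open>r\<close> the length scale of the kernel.
  Within distance \<open>r\<close> of \<open>z\<close>, moving from \<open>x\<close> to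
  \<open>z\<close> changes the distance to \<open>y\<close> by at most one unit of \<open>r\<close>,
  which costs a factor \<open>2 powr q\<close>. The bound is thus uniform in \<open>x\<close> over
  the ball.\<close>

lemma heat_kernel_weight_bound:
  fixes k :: "real \<Rightarrow> 'a::euclidean_space \<Rightarrow> 'a \<Rightarrow> complex"
  assumes "heat_kernel_bound m g k" "0 < m"
  obtains A \<beta> where "0 \<le> A" "0 < \<beta>"
    "\<And>r x y z. 0 < r \<Longrightarrow> norm (x - z) \<le> r \<Longrightarrow> norm (k (r powr m) x y)
      \<le> A * r powr (- real DIM('a)) * (1 + norm (y - z) / r) powr (- (real DIM('a) + \<beta>))"
proof -
  obtain A \<beta> where A: "0 \<le> A" and \<beta>: "0 < \<beta>"
    and g: "\<And>u. 0 \<le> u \<Longrightarrow> g u \<le> A * (1 + u) powr (- (real DIM('a) + \<beta>))"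
    using assms admissible_profile_decay unfolding heat_kernel_bound_def by metis
  have g0: "0 \<le> g u" if "0 \<le> u" for u
    using assms(1) that by (auto simp: heat_kernel_bound_def admissible_profile_def less_imp_le)
  obtain c where c: "\<And>t x y. 0 < t \<Longrightarrow> norm (k t x y)
      \<le> c * t powr (- (real DIM('a) / m)) * g (norm (x - y) / t powr (1 / m))"
    using assms(1) unfolding heat_kernel_bound_def by blast
  define q where "q = real DIM('a) + \<beta>"
  have q: "0 < q" using \<beta> by (simp add: q_def add_pos_pos)
  have half: "(w / 2) powr (- q) = 2 powr q * w powr (- q)" if "0 \<le> w" for w
    using that by (simp add: powr_divide powr_minus field_simps)
  show thesis
  proof (rule that[of "\<bar>c\<bar> * A * 2 powr q" \<beta>])
    fix r and x y z :: 'a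
    assume r: "0 < r" and xz: "norm (x - z) \<le> r"
    let ?u = "norm (x - y) / r" and ?v = "norm (y - z) / r"
    have "(1 + ?u) powr (- q) \<le> ((1 + ?v) / 2) powr (- q)"
    proof (rule powr_mono2')
      have "norm (y - z) \<le> norm (x - y) + norm (x - z)"
        using norm_triangle_ineq4[of "x - z" "x - y"] by simp
      then have "?v \<le> ?u + 1"
        using r xz by (simp add: field_simps)
      moreover have "0 \<le> ?u" using r by simp
      ultimately show "(1 + ?v) / 2 \<le> 1 + ?u" by argo
      show "0 < (1 + ?v) / 2" using r by (simp add: add_pos_nonneg)
    qed (use q in simp)
    also have "\<dots> = 2 powr q * (1 + ?v) powr (- q)"
      using r by (intro half) (simp add: add_nonneg_nonneg)
    finally have decay: "(1 + ?u) powr (- q) \<le> 2 powr q * (1 + ?v) powr (- q)" .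
    have "norm (k (r powr m) x y) \<le> c * r powr (- real DIM('a)) * g ?u"
      using c[of "r powr m" x y] r \<open>0 < m\<close> by (simp add: powr_powr)
    \<comment> \<open>The sign of \<open>c\<close> is not prescribed, and the next estimates need a
      nonnegative factor.\<close>
    also have "\<dots> \<le> \<bar>c\<bar> * r powr (- real DIM('a)) * g ?u"
      using r g0 by (intro mult_right_mono) auto
    also have "\<dots> \<le> \<bar>c\<bar> * r powr (- real DIM('a)) * (A * (1 + ?u) powr (- q))"
      using r g[of ?u] by (intro mult_left_mono) (auto simp: q_def)
    also have "\<dots> \<le> \<bar>c\<bar> * r powr (- real DIM('a)) * (A * (2 powr q * (1 + ?v) powr (- q)))"
      using A by (intro mult_left_mono decay) auto
    finally show "norm (k (r powr m) x y) \<le> \<bar>c\<bar> * A * 2 powr q * r powr (- real DIM('a)) *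
        (1 + ?v) powr (- (real DIM('a) + \<beta>))"
      unfolding q_def by (simp only: mult_ac)
  qed (use A \<beta> in auto)
qed

section \<open>Sufficiency: the oscillation relative to the semigroup, and admissible growth\<close>

context morrey_function
begin

text \<open>By \<open>kernel_integral\<close>, \<open>norm (f x - P x)\<close> exceeds
  \<open>norm (f x - ball_mean f z r)\<close> by at most a constant \<open>d\<close> almost
  everywhere on the ball; taking \<open>p\<close>-th powers and integrating gives the claim.\<close>

lemma morrey_osc_L_le:
  assumes r: "0 < r" and \<beta>: "0 < \<beta>" and A: "0 \<le> A" and lep: "\<And>x y. norm (x - z) \<le> r \<Longrightarrow>
      norm (k (r powr m) x y) \<le> A * r powr (- n) * (1 + norm (y - z) / r) powr (- (n + \<beta>))"
    and k: "(\<lambda>(x, y). k (r powr m) x y) \<in> borel_measurable lebesgue"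
    and 1: "AE x in lebesgue. kernel_op k (r powr m) (\<lambda>_. 1) x = 1"
  shows "set_integrable lebesgue (ball z r) (\<lambda>x. norm (f x - kernel_op k (r powr m) f x) powr p)"
    and "morrey_osc_L k m p lam f (z, r)
      \<le> 2 * (1 + (A * weight_const n \<beta> * (V + C)) powr p * V) powr (1 / p) * N"
proof -
  define K where "K = A * weight_const n \<beta> * (V + C)"
  define P where "P = kernel_op k (r powr m) f"
  define d where "d = K * N * r powr s"
  let ?F = "\<lambda>x. norm (f x - ball_mean f z r) powr p"
  have W: "0 \<le> weight_const n \<beta>"
    unfolding weight_const_def using \<beta> by (simp add: powr_less_one less_imp_le)
  have K: "0 \<le> K"
    unfolding K_def using A W V_pos C_pos by (intro mult_nonneg_nonneg) auto
  have d: "0 \<le> d" using K N by (simp add: d_def)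
  note kernel = kernel_op_measurable[where k = k and t = "r powr m", OF k f_measurable]
  have Pm: "P \<in> borel_measurable lebesgue"
    unfolding P_def by (rule kernel(1))
  \<comment> \<open>Exceptional \<open>x\<close> arise where the section of the kernel is not
    measurable or its mass is not 1.\<close>
  have "AE x in lebesgue. x \<in> ball z r \<longrightarrow> norm (f x - P x) \<le> norm (f x - ball_mean f z r) + d"
    using 1 kernel(2)
  proof eventually_elim
    case (elim x)
    show ?case
    proof
      assume "x \<in> ball z r"
      then have "norm (x - z) \<le> r" by (simp add: dist_norm norm_minus_commute)
      from kernel_integral(2)[OF r \<beta> elim(2) lep[OF this], of "f x"] elim(1)
      have "norm (f x - P x) \<le> norm (f x - ball_mean f z r) +
          A * r powr (- n) * weight_const n \<beta> * (V + C) * N * r powr s * r powr n"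
        by (simp add: P_def kernel_op_def)
      \<comment> \<open>The kernel normalisation \<open>r powr (- n)\<close> cancels the volume
        factor of the weighted integral.\<close>
      also have "A * r powr (- n) * weight_const n \<beta> * (V + C) * N * r powr s * r powr n = d"
        using r by (simp add: d_def K_def powr_minus)
      finally show "norm (f x - P x) \<le> norm (f x - ball_mean f z r) + d" .
    qed
  qed
  then have le: "AE x in lebesgue. x \<in> ball z r \<longrightarrow> norm (f x - P x) powr p \<le> 2 powr p * (?F x + d powr p)"
  proof eventually_elim
    case (elim x)
    have "(norm (f x - ball_mean f z r) + d) powr p \<le> 2 powr p * (?F x + d powr p)"
      using p d by (intro powr_add_le) auto
    then show ?case
      using elim p by (auto intro: order_trans[OF powr_mono2])
  qed
  have F: "set_integrable lebesgue (ball z r) ?F"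
    by (rule Lp_loc_diff_powr_ball[OF p f])
  have B: "set_integrable lebesgue (ball z r) (\<lambda>x. 2 powr p * (?F x + d powr p))"
    by (intro set_integrable_mult_right set_integral_add(1) F set_integrable_const_ball)
  have I: "set_integrable lebesgue (ball z r) (\<lambda>x. norm (f x - P x) powr p)"
  proof (rule set_integrable_bound[OF B])
    show "set_borel_measurable lebesgue (ball z r) (\<lambda>x. norm (f x - P x) powr p)"
      unfolding set_borel_measurable_def using f_measurable Pm
      by (intro borel_measurable_scaleR borel_measurable_indicator powr_real_measurable
          measurable_compose[OF _ borel_measurable_norm] borel_measurable_diff
          borel_measurable_const) auto
    show "AE x in lebesgue. x \<in> ball z r \<longrightarrow> norm (norm (f x - P x) powr p)
        \<le> norm (2 powr p * (?F x + d powr p))"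
      using le by eventually_elim auto
  qed
  then show "set_integrable lebesgue (ball z r) (\<lambda>x. norm (f x - kernel_op k (r powr m) f x) powr p)"
    by (simp add: P_def)
  have "(LINT x:ball z r|lebesgue. norm (f x - P x) powr p)
      \<le> (LINT x:ball z r|lebesgue. 2 powr p * (?F x + d powr p))"
    using le by (intro set_integral_mono_AE I B) auto
  also have "\<dots> = 2 powr p * ((LINT x:ball z r|lebesgue. ?F x) + V * r powr n * d powr p)"
    using r by (simp add: set_integral_add(2)[OF F set_integrable_const_ball]
        set_lebesgue_integral_const_ball content_ball powr_realpow n)
  also have "\<dots> \<le> 2 powr p * (N powr p * r powr lam + V * r powr n * d powr p)"
    by (intro mult_left_mono add_right_mono osc r) simp
  also have "V * r powr n * d powr p = V * K powr p * N powr p * (r powr n * r powr (s * p))"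
    using K N r by (simp add: d_def powr_mult powr_powr)
  also have "r powr n * r powr (s * p) = r powr lam"
    using p r by (simp add: powr_add[symmetric])
  also have "2 powr p * (N powr p * r powr lam + V * K powr p * N powr p * r powr lam) =
      (2 * N) powr p * (1 + K powr p * V) * r powr lam"
    using N by (simp add: powr_mult algebra_simps)
  finally have "r powr (- lam) * (LINT x:ball z r|lebesgue. norm (f x - P x) powr p)
      \<le> r powr (- lam) * ((2 * N) powr p * (1 + K powr p * V) * r powr lam)"
    by (intro mult_left_mono) auto
  also have "\<dots> = (2 * N) powr p * (1 + K powr p * V)"
    using r by (simp add: powr_minus)
  finally have "(r powr (- lam) * (LINT x:ball z r|lebesgue. norm (f x - P x) powr p)) powr (1 / p)
      \<le> ((2 * N) powr p * (1 + K powr p * V)) powr (1 / p)"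
    using p by (intro powr_mono2 mult_nonneg_nonneg)
      (auto simp: set_lebesgue_integral_def intro!: integral_nonneg_AE)
  also have "\<dots> = 2 * (1 + K powr p * V) powr (1 / p) * N"
    using p N V_pos by (simp add: powr_mult powr_powr)
  finally show "morrey_osc_L k m p lam f (z, r)
      \<le> 2 * (1 + (A * weight_const n \<beta> * (V + C)) powr p * V) powr (1 / p) * N"
    by (simp add: morrey_osc_L_def P_def K_def)
qed

text \<open>Since \<open>mem_M_class\<close> holds for every positive exponent, only positivity of
  \<open>Theta\<close> matters, and any admissible decay exponent of \<open>g\<close> provides
  it.\<close>

lemma mem_M_space:
  assumes "admissible_profile DIM('a) g"
  shows "f \<in> M_space p g"
proof (cases "Theta DIM('a) g = \<infinity>")
  case True
  then show ?thesis using mem_M_class[of 1] by (auto simp: M_space_def intro!: bexI[of _ 1])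
next
  case False
  obtain \<epsilon> where \<epsilon>: "0 < \<epsilon>" "((\<lambda>r. r powr (real DIM('a) + \<epsilon>) * g r) \<longlongrightarrow> 0) at_top"
    using assms by (auto simp: admissible_profile_def)
  then have "ereal \<epsilon> \<le> Theta DIM('a) g"
    unfolding Theta_def by (intro Sup_upper) auto
  then have "0 < real_of_ereal (Theta DIM('a) g)"
    using \<epsilon> False by (cases "Theta DIM('a) g") auto
  then show ?thesis using False mem_M_class by (simp add: M_space_def)
qed

end

section \<open>Integral bounds from the Morrey norm\<close>

lemma morrey_osc_nonneg: "0 \<le> morrey_osc p lam f B"
  by (cases B) (simp add: morrey_osc_def)

lemma morrey_osc_le_norm:
  assumes "f \<in> morrey_space p lam" "0 < r"
  shows "morrey_osc p lam f (z, r) \<le> morrey_norm p lam f"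
  unfolding morrey_norm_def using assms by (intro cSUP_upper) (auto simp: morrey_space_def)

text \<open>The norm is nonnegative, so the strict inequality makes \<open>N\<close> positive; the
  \<open>p\<close>-th power undoes the root in \<open>morrey_osc\<close>.\<close>

lemma morrey_function_of_norm_less:
  fixes f :: "'a::euclidean_space \<Rightarrow> complex"
  assumes p: "1 \<le> p" and lam: "0 < lam" "lam < real DIM('a)"
    and f: "f \<in> morrey_space p lam" and N: "morrey_norm p lam f < N"
  shows "morrey_function f (real DIM('a)) p lam N"
proof
  show "0 < N"
    using N morrey_osc_nonneg morrey_osc_le_norm[OF f zero_less_one] by (meson less_le_trans order.strict_trans1)
  show "f \<in> Lp_loc p" using f by (simp add: morrey_space_def)
  fix z :: 'a and r :: real assume r: "0 < r"
  define X where "X = r powr (- lam) * (LINT x:ball z r|lebesgue. norm (f x - ball_mean f z r) powr p)"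
  have X: "0 \<le> X"
    unfolding X_def by (intro mult_nonneg_nonneg)
      (auto simp: set_lebesgue_integral_def intro!: integral_nonneg_AE)
  have "X powr (1 / p) \<le> N"
    using morrey_osc_le_norm[OF f r, of z] N by (simp add: morrey_osc_def X_def)
  then have "(X powr (1 / p)) powr p \<le> N powr p"
    using p by (intro powr_mono2) auto
  then have "X \<le> N powr p" using p X by (simp add: powr_powr)
  then have "r powr lam * X \<le> r powr lam * N powr p"
    by (intro mult_left_mono) auto
  then show "(LINT x:ball z r|lebesgue. norm (f x - ball_mean f z r) powr p) \<le> N powr p * r powr lam"
    using r by (simp add: X_def mult.assoc[symmetric] powr_add[symmetric] mult.commute)
qed (use assms in auto)

section \<open>Necessity: constants as test functions\<close>

lemma morrey_osc_const: "0 < r \<Longrightarrow> morrey_osc p lam (\<lambda>_. c) (z, r) = 0"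
proof -
  assume r: "0 < r"
  have "0 < measure lebesgue (ball z r)" using r by (simp add: content_ball_pos)
  then have "ball_mean (\<lambda>_. c) z r = c"
    by (simp add: ball_mean_def set_lebesgue_integral_const_ball)
  then show ?thesis by (simp add: morrey_osc_def set_lebesgue_integral_def)
qed

lemma const_mem_morrey_space: "(\<lambda>_::'a::euclidean_space. c) \<in> morrey_space p lam"
proof -
  have "set_integrable lebesgue K (\<lambda>x::'a. norm c powr p)" if "compact K" for K
    unfolding set_integrable_def using lmeasurable_compact[OF that]
    by (intro integrable_scaleR_left integrable_real_indicator) (auto simp: fmeasurable_def)
  moreover have "morrey_osc p lam (\<lambda>_::'a. c) B = 0" if "B \<in> UNIV \<times> {0<..}" for B :: "'a \<times> real"
    using that by (cases B) (simp add: morrey_osc_const)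
  then have "bdd_above (morrey_osc p lam (\<lambda>_::'a. c) ` (UNIV \<times> {0<..}))"
    by (intro bdd_aboveI[of _ 0]) auto
  ultimately show ?thesis
    by (simp add: morrey_space_def Lp_loc_def)
qed

lemma morrey_norm_const: "morrey_norm p lam (\<lambda>_::'a::euclidean_space. c) = 0"
proof -
  have "morrey_norm p lam (\<lambda>_::'a. c) = (SUP B\<in>(UNIV :: 'a set) \<times> {0::real<..}. 0)"
    unfolding morrey_norm_def by (intro SUP_cong) (auto simp: morrey_osc_const)
  also have "\<dots> = 0" by (subst cSUP_const) auto
  finally show ?thesis .
qed

text \<open>Balls of one fixed radius around a countable dense set cover the space, so only
  countably many null sets are united. The radius is fixed because the time \<open>t\<close>
  determines it.\<close>

lemma AE_of_AE_balls:
  fixes P :: "'a::euclidean_space \<Rightarrow> bool"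
  assumes r: "0 < r" and ball: "\<And>z. AE x in lebesgue. x \<in> ball z r \<longrightarrow> P x"
  shows "AE x in lebesgue. P x"
proof -
  obtain D :: "'a set" where D: "countable D" "\<And>X. open X \<Longrightarrow> X \<noteq> {} \<Longrightarrow> \<exists>d\<in>D. d \<in> X"
    using countable_dense_setE by metis
  have "AE x in lebesgue. \<forall>z\<in>D. x \<in> ball z r \<longrightarrow> P x"
    using D(1) ball by (intro AE_ball_countable') auto
  then show ?thesis
  proof eventually_elim
    case (elim x)
    obtain z where "z \<in> D" "z \<in> ball x r" using D(2)[of "ball x r"] r by auto
    then show ?case using elim by (auto simp: dist_commute)
  qed
qed

text \<open>On balls of radius \<open>t powr (1 / m)\<close> the semigroup time is exactly
  \<open>t\<close>. A vanishing norm makes the integral of a nonnegative function over each such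
  ball vanish.\<close>

lemma kernel_op_one_of_inclusion:
  fixes k :: "real \<Rightarrow> 'a::euclidean_space \<Rightarrow> 'a \<Rightarrow> complex"
  assumes p: "1 \<le> p" and "m > 0" and "t > 0"
    and sub: "(\<lambda>_. 1) \<in> morrey_space_L k m g p lam"
    and le: "morrey_norm_L k m p lam (\<lambda>_. 1) \<le> 0"
  shows "AE x in lebesgue. kernel_op k t (\<lambda>_. 1) x = 1"
proof (rule AE_of_AE_balls)
  define r where "r = t powr (1 / m)"
  show r: "0 < r" using \<open>t > 0\<close> by (simp add: r_def)
  have t: "r powr m = t" using assms(2,3) by (simp add: r_def powr_powr)
  fix z :: 'a
  let ?h = "\<lambda>x. norm (1 - kernel_op k t (\<lambda>_. 1) x) powr p"
  have i: "set_integrable lebesgue (ball z r) ?h"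
    and bdd: "bdd_above (morrey_osc_L k m p lam (\<lambda>_. 1) ` (UNIV \<times> {0<..}))"
    using sub r t by (auto simp: morrey_space_L_def)
  have "morrey_osc_L k m p lam (\<lambda>_. 1) (z, r) \<le> morrey_norm_L k m p lam (\<lambda>_. 1)"
    unfolding morrey_norm_L_def using bdd r by (intro cSUP_upper) auto
  then have "(r powr (- lam) * (LINT x:ball z r|lebesgue. ?h x)) powr (1 / p) \<le> 0"
    using le unfolding morrey_osc_L_def prod.case t by (rule order_trans)
  then have "(LINT x:ball z r|lebesgue. ?h x) = 0"
    using r by simp
  \<comment> \<open>The integrability clause of \<open>morrey_space_L\<close> is essential here: for
    a non-integrable function the integral would be 0 by default.\<close>
  then have "AE x in lebesgue. indicat_real (ball z r) x *\<^sub>R ?h x = 0"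
    using i unfolding set_lebesgue_integral_def set_integrable_def
    by (subst (asm) integral_nonneg_eq_0_iff_AE) auto
  then show "AE x in lebesgue. x \<in> ball z r \<longrightarrow> kernel_op k t (\<lambda>_. 1) x = 1"
    by eventually_elim (auto simp: indicator_def)
qed

section \<open>Equivalence of the norm inclusion and conservation of constants\<close>

theorem proposition3p3:
  fixes L :: "(real ^ 'n) operator"
    and T :: "real \<Rightarrow> (real ^ 'n \<Rightarrow> complex) \<Rightarrow> (real ^ 'n \<Rightarrow> complex)"
    and k :: "real \<Rightarrow> real ^ 'n \<Rightarrow> real ^ 'n \<Rightarrow> complex"
    and g :: "real \<Rightarrow> real"
    and \<omega> m p lam :: real
  assumes "1 \<le> p"
    and "0 < lam" and "lam < real CARD('n)"
    and "0 \<le> \<omega>" and "\<omega> < pi / 2" and "operator_of_type \<omega> L"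
    and "generates_semigroup L T"
    and "represented_by_kernel T k"
    and "m > 0" and "heat_kernel_bound m g k"
  shows "((morrey_space p lam :: (real ^ 'n \<Rightarrow> complex) set) \<subseteq> morrey_space_L k m g p lam \<and>
          (\<exists>c>0. \<forall>f \<in> (morrey_space p lam :: (real ^ 'n \<Rightarrow> complex) set).
             morrey_norm_L k m p lam f \<le> c * morrey_norm p lam f))
     \<longleftrightarrow> (\<forall>t>0. AE x in lebesgue. kernel_op k t (\<lambda>_. 1) x = 1)"
proof
  assume lhs: "(morrey_space p lam :: (real ^ 'n \<Rightarrow> complex) set) \<subseteq> morrey_space_L k m g p lam \<and>
          (\<exists>c>0. \<forall>f \<in> (morrey_space p lam :: (real ^ 'n \<Rightarrow> complex) set).
             morrey_norm_L k m p lam f \<le> c * morrey_norm p lam f)"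
  note one = const_mem_morrey_space[of 1 p lam, where ?'a = "real ^ 'n"]
  have "(\<lambda>_. 1) \<in> morrey_space_L k m g p lam" using lhs one by blast
  moreover have "morrey_norm_L k m p lam (\<lambda>_. 1) \<le> 0"
    using lhs one morrey_norm_const[of p lam 1, where ?'a = "real ^ 'n"] by fastforce
  ultimately show "\<forall>t>0. AE x in lebesgue. kernel_op k t (\<lambda>_. 1) x = 1"
    using kernel_op_one_of_inclusion[OF \<open>1 \<le> p\<close> \<open>m > 0\<close>] by blast
next
  assume 1: "\<forall>t>0. AE x in lebesgue. kernel_op k t (\<lambda>_. 1) x = 1"
  define n where "n = real DIM(real ^ 'n)"
  have lam: "lam < real DIM(real ^ 'n)" using assms(3) by simp
  have profile: "admissible_profile DIM(real ^ 'n) g"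
    using assms(10) by (simp add: heat_kernel_bound_def)
  have km: "(\<lambda>(x, y). k t x y) \<in> borel_measurable lebesgue" if "0 < t" for t
    using assms(8) that by (simp add: represented_by_kernel_def)
  obtain A \<beta> where A: "0 \<le> A" and \<beta>: "0 < \<beta>" and bound: "\<And>r x y z. 0 < r \<Longrightarrow> norm (x - z) \<le> r \<Longrightarrow>
      norm (k (r powr m) x y) \<le> A * r powr (- n) * (1 + norm (y - z) / r) powr (- (n + \<beta>))"
    by (rule heat_kernel_weight_bound[OF assms(10,9), folded n_def]) (rule that)
  \<comment> \<open>The factor of \<open>N\<close> in \<open>morrey_osc_L_le\<close>; it does not
    depend on \<open>f\<close>, on the ball or on \<open>N\<close>.\<close>
  define c where "c = 2 * (1 + (A * weight_const n \<beta> * (unit_ball_vol n + osc_const n p lam)) powr p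
    * unit_ball_vol n) powr (1 / p)"
  have "0 < 1 + X powr p * unit_ball_vol n" for X
    by (simp add: n_def add_pos_nonneg)
  then have c: "0 < c"
    unfolding c_def by (simp add: less_imp_neq[symmetric])
  {
    fix f :: "real ^ 'n \<Rightarrow> complex"
    assume f: "f \<in> morrey_space p lam"
    have mf: "morrey_function f n p lam N" if "morrey_norm p lam f < N" for N
      unfolding n_def by (rule morrey_function_of_norm_less[OF assms(1,2) lam f that])
    have oscL: "set_integrable lebesgue (ball z r) (\<lambda>x. norm (f x - kernel_op k (r powr m) f x) powr p)"
      "morrey_osc_L k m p lam f (z, r) \<le> c * N"
      if "morrey_norm p lam f < N" "0 < r" for N z r
      using morrey_function.morrey_osc_L_le[OF mf[OF that(1)] that(2) \<beta> A bound[OF that(2)] km 1[rule_format]]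
        that(2) by (simp_all add: c_def)
    have osc_le: "morrey_osc_L k m p lam f (z, r) \<le> c * morrey_norm p lam f" if "0 < r" for z r
    \<comment> \<open>The estimate holds for every \<open>N\<close> above the norm; taking
      \<open>N\<close> as the norm plus \<open>e / c\<close> and letting \<open>e\<close> tend to 0
      reaches the norm itself, including the case of norm 0.\<close>
    proof (rule field_le_epsilon)
      fix e :: real assume "0 < e"
      then have "morrey_osc_L k m p lam f (z, r) \<le> c * (morrey_norm p lam f + e / c)"
        using c by (intro oscL(2) that) simp
      also have "\<dots> = c * morrey_norm p lam f + e"
        using c by (simp add: distrib_left)
      finally show "morrey_osc_L k m p lam f (z, r) \<le> c * morrey_norm p lam f + e" .
    qed
    \<comment> \<open>For the qualitative memberships any \<open>N\<close> above the norm
      serves.\<close>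
    interpret morrey_function f n p lam "morrey_norm p lam f + 1"
      by (rule mf) simp
    have "f \<in> M_space p g" by (rule mem_M_space[OF profile])
    moreover have "AE x in lebesgue. integrable lebesgue (\<lambda>y. k t x y * f y)" if t: "0 < t" for t
      using kernel_op_measurable(2)[where k = k and t = t, OF km[OF t] f_measurable]
    proof eventually_elim
      case (elim x)
      define r where "r = t powr (1 / m)"
      have r: "0 < r" "r powr m = t" using t \<open>m > 0\<close> by (simp_all add: r_def powr_powr)
      \<comment> \<open>The ball is centred at \<open>x\<close> itself; integrability of the product
        needs no condition on the mass of the kernel.\<close>
      have "norm (k t x y) \<le> A * r powr (- n) * (1 + norm (y - x) / r) powr (- (n + \<beta>))" for y
        using bound[of r x x y] r by simp
      then show ?case by (rule kernel_integral(1)[OF r(1) \<beta> elim])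
    qed
    moreover have "bdd_above (morrey_osc_L k m p lam f ` (UNIV \<times> {0<..}))"
      using osc_le by (intro bdd_aboveI[of _ "c * morrey_norm p lam f"]) auto
    ultimately have "f \<in> morrey_space_L k m g p lam"
      using oscL(1)[of "morrey_norm p lam f + 1"] by (simp add: morrey_space_L_def)
    moreover have "morrey_norm_L k m p lam f \<le> c * morrey_norm p lam f"
      unfolding morrey_norm_L_def by (rule cSUP_least) (use osc_le in auto)
    ultimately have "f \<in> morrey_space_L k m g p lam \<and> morrey_norm_L k m p lam f \<le> c * morrey_norm p lam f" ..
  }
  then show "(morrey_space p lam :: (real ^ 'n \<Rightarrow> complex) set) \<subseteq> morrey_space_L k m g p lam \<and>
          (\<exists>c>0. \<forall>f \<in> (morrey_space p lam :: (real ^ 'n \<Rightarrow> complex) set).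
             morrey_norm_L k m p lam f \<le> c * morrey_norm p lam f)"
    using c by blast
qed

end
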